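(* Let $\mathcal{S}$ be a finite left regular band of groups with support map $\mathsf{supp}:\mathcal{S}\to\mathcal{T}=\mathcal{S}/\!\sim$, and let $\{\mathfrak{e}^\circ_X\}_{X\in E(\mathcal{T})}$ be a complete system of primitive orthogonal idempotents of the algebra $\mathbb{C}E(\mathcal{S})$ (indexed as described in the context). For each $X\in E(\mathcal{T})$ fix an element $x\in E(\mathcal{S})$ with $\mathsf{supp}(x)=X$ and a complete system of primitive orthogonal idempotents $\{\mathbf{E}^{(i)}_X\}_{i\in I_X}$ of the group algebra $\mathbb{C}G_x\subseteq\mathbb{C}\mathcal{S}$. Define $$\mathfrak{e}_{(X,i)}:=\mathfrak{e}^\circ_X\,\mathbf{E}^{(i)}_X\,\mathfrak{e}^\circ_X\in\mathbb{C}\mathcal{S}.$$ Then $\{\mathfrak{e}_{(X,i)}\}_{X\in E(\mathcal{T}),\,i\in I_X}$ is a complete system of primitive orthogonal idempotents of $\mathbb{C}\mathcal{S}$.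
   Context: All semigroups are finite. For $s$ in a finite semigroup $\mathcal{S}$, $s^\omega$ denotes the unique idempotent that is a positive power of $s$. A finite semigroup $\mathcal{S}$ is a left regular band of groups (LRBG) if $s^\omega s=s$ and $sts^\omega=st$ for all $s,t\in\mathcal{S}$. $E(\mathcal{S})$ is the set of idempotents of $\mathcal{S}$; it is a subsemigroup and a left regular band ($x^2=x$, $xyx=xy$). For $x\in E(\mathcal{S})$, $G_x=\{s\in\mathcal{S}: s^\omega=x\}$ is a subgroup of $\mathcal{S}$ with identity $x$. The relation $s\sim t$ iff ($s^\omega t=s$ and $t^\omega s=t$) is a semigroup congruence; $\mathcal{T}=\mathcal{S}/\!\sim$ and $\mathsf{supp}:\mathcal{S}\to\mathcal{T}$ is the quotient map; $E(\mathcal{T})=\mathsf{supp}(E(\mathcal{S}))$, partially ordered by $X\le Y$ iff $XY=Y$. $\mathbb{C}\mathcal{S}$ is the semigroup algebra with basis $\{\mathbf{H}_s\}_{s\in\mathcal{S}}$, $\mathbf{H}_s\mathbf{H}_t=\mathbf{H}_{st}$; $\mathbb{C}E(\mathcal{S})$ and $\mathbb{C}G_x$ are the subalgebras spanned by the corresponding $\mathbf{H}_s$. A complete system of primitive orthogonal idempotents (CSoPOI) of a unital algebra $A$ is a family of primitive idempotents $e_i$ with $e_ie_j=\delta_{ij}e_i$ and $\sum_i e_i=1_A$. A homogeneous section is a family $\{\mathfrak{u}_X\}_{X\in E(\mathcal{T})}$ with $\mathfrak{u}_X=\sum_{x\in E(\mathcal{S}),\,\mathsf{supp}(x)=X}c_x\mathbf{H}_x$,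 $c_x\in\mathbb{C}$, $\sum_{\mathsf{supp}(x)=X}c_x=1$. Given one, elements $\mathfrak{e}^\circ_X$ are defined recursively by $\mathfrak{e}^\circ_X=\mathfrak{u}_X-\sum_{Y\in E(\mathcal{T}),\,Y>X}\mathfrak{u}_X\mathfrak{e}^\circ_Y$; these form a CSoPOI of $\mathbb{C}E(\mathcal{S})$, every CSoPOI of $\mathbb{C}E(\mathcal{S})$ arises in this way, and "a CSoPOI $\{\mathfrak{e}^\circ_X\}_{X\in E(\mathcal{T})}$ of $\mathbb{C}E(\mathcal{S})$" means one indexed in this way. *)

theory Defs
  imports Complex_Main
begin

section \<open>The idempotent power\<close>

text \<open>In a semigroup there is no zeroth power; \<open>((*) s ^^ n) s\<close> is $s^{n+1}$.\<close>

definition (in semigroup_mult) pos_powers :: "'a \<Rightarrow> 'a set" where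
  "pos_powers s = range (\<lambda>n. ((*) s ^^ n) s)"

definition (in semigroup_mult) omega :: "'a \<Rightarrow> 'a" where
  "omega s = (THE e. e \<in> pos_powers s \<and> e * e = e)"

lemma spow_add:
  fixes s :: "'a::semigroup_mult"
  shows "((*) s ^^ m) s * ((*) s ^^ n) s = ((*) s ^^ (m + n + 1)) s"
  by (induction m) (simp_all add: mult.assoc)

lemma spow_spow:
  fixes s :: "'a::semigroup_mult"
  shows "((*) (((*) s ^^ n) s) ^^ m) (((*) s ^^ n) s) = ((*) s ^^ ((m + 1) * (n + 1) - 1)) s"
  by (induction m) (simp_all add: spow_add algebra_simps)

lemma spow_idem:
  fixes e :: "'a::semigroup_mult"
  assumes "e * e = e"
  shows "((*) e ^^ n) e = e"
  by (induction n) (simp_all add: assms)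

lemma omega_ex1:
  fixes s :: "'a::{semigroup_mult,finite}"
  shows "\<exists>!e. e \<in> pos_powers s \<and> e * e = e"
proof (rule ex_ex1I)
  define p where "p n = ((*) s ^^ n) s" for n
  have p_add: "p m * p n = p (m + n + 1)" for m n
    unfolding p_def by (rule spow_add)
  have "\<not> inj p"
    using finite_imageD[of p UNIV] by auto
  then obtain i j where ij: "i < j" "p i = p j"
    by (metis injI linorder_neqE_nat)
  define d where "d = j - i"
  have d: "d > 0" using ij by (simp add: d_def)
  have per1: "p (k + d) = p k" if "k \<ge> i" for k
  proof (cases "k = i")
    case True
    then show ?thesis using ij by (simp add: d_def)
  next
    case False
    then have k: "k = i + (k - i - 1) + 1" using that by simp
    have "p (k + d) = p (j + (k - i - 1) + 1)"
      using ij that False by (intro arg_cong[of _ _ p]) (simp add: d_def)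
    also have "\<dots> = p (i + (k - i - 1) + 1)"
      using p_add[of j "k - i - 1"] p_add[of i "k - i - 1"] ij(2) by simp
    finally show ?thesis using k by simp
  qed
  have per: "p (k + m * d) = p k" if "k \<ge> i" for k m
  proof (induction m)
    case (Suc m)
    have "p (k + Suc m * d) = p ((k + m * d) + d)" by (simp add: algebra_simps)
    also have "\<dots> = p k" using per1[of "k + m * d"] that Suc by simp
    finally show ?case .
  qed simp
  define k where "k = (i + 1) * d - 1"
  have k1: "k + 1 = (i + 1) * d" using d by (simp add: k_def)
  have "(i + 1) * 1 \<le> (i + 1) * d" using d by (intro mult_le_mono2) simp
  then have "k \<ge> i" using k1 by simp
  then have "p (k + (i + 1) * d) = p k" by (rule per)
  then have "p k * p k = p k" by (simp only: p_add k1[symmetric] add.assoc)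
  then show "\<exists>e. e \<in> pos_powers s \<and> e * e = e"
    unfolding pos_powers_def p_def by blast
next
  fix e f
  assume e: "e \<in> pos_powers s \<and> e * e = e" and f: "f \<in> pos_powers s \<and> f * f = f"
  then obtain m n where mn: "e = ((*) s ^^ m) s" "f = ((*) s ^^ n) s"
    unfolding pos_powers_def by auto
  have "e = ((*) e ^^ n) e" using e by (simp add: spow_idem)
  also have "\<dots> = ((*) s ^^ ((n + 1) * (m + 1) - 1)) s"
    unfolding mn(1) by (rule spow_spow)
  also have "\<dots> = ((*) s ^^ ((m + 1) * (n + 1) - 1)) s"
    by (simp only: mult.commute)
  also have "\<dots> = ((*) f ^^ m) f"
    unfolding mn(2) by (rule spow_spow[symmetric])
  also have "\<dots> = f" using f by (simp add: spow_idem)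
  finally show "e = f" .
qed

lemma omega_in: "omega s \<in> pos_powers (s :: 'a::{semigroup_mult,finite})"
  and omega_idem: "omega s * omega s = omega s"
  unfolding omega_def using theI'[OF omega_ex1[of s]] by blast+


section \<open>Left regular bands of groups\<close>

class lrbg = semigroup_mult + finite +
  assumes omega_mult_self: "omega s * s = s"
    and mult_mult_omega: "s * t * omega s = s * t"

definition E_S :: "'a::lrbg set" where
  "E_S = {x. x * x = x}"

definition G_S :: "'a::lrbg \<Rightarrow> 'a set" where
  "G_S x = {s. omega s = x}"

definition sim :: "('a::lrbg \<times> 'a) set" where
  "sim = {(s, t). omega s * t = s \<and> omega t * s = t}"

text \<open>The quotient semigroup consists of the classes of \<^const>\<open>sim\<close>, so its elements
  have type \<^typ>\<open>'a set\<close>; its product is \<open>T_mult\<close> (see \<open>T_mult_supp\<close> below).\<close>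

definition supp :: "'a::lrbg \<Rightarrow> 'a set" where
  "supp s = sim `` {s}"

definition T_mult :: "'a::lrbg set \<Rightarrow> 'a set \<Rightarrow> 'a set" where
  "T_mult X Y = (\<Union>s\<in>X. \<Union>t\<in>Y. supp (s * t))"

definition E_T :: "'a::lrbg set set" where
  "E_T = supp ` E_S"

definition T_le :: "'a::lrbg set \<Rightarrow> 'a set \<Rightarrow> bool" where
  "T_le X Y \<longleftrightarrow> T_mult X Y = Y"

definition T_less :: "'a::lrbg set \<Rightarrow> 'a set \<Rightarrow> bool" where
  "T_less X Y \<longleftrightarrow> T_le X Y \<and> X \<noteq> Y"

lemma mult_omega_self: "s * omega s = (s::'a::lrbg)"
proof -
  obtain n where n: "omega s = ((*) s ^^ n) s"
    using omega_in[of s] unfolding pos_powers_def by auto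
  have "s * omega s = omega s * s"
    unfolding n using spow_add[of 0 s n] spow_add[of n s 0] by simp
  then show ?thesis by (simp add: omega_mult_self)
qed

lemma sim_omega_mult:
  assumes "(s, t) \<in> sim"
  shows "omega s * omega t = omega (s::'a::lrbg)"
proof -
  have *: "s * omega t = s"
  proof -
    have "omega s * t = s" using assms by (simp add: sim_def)
    then show ?thesis using mult.assoc[of "omega s" t "omega t"] by (simp add: mult_omega_self)
  qed
  have "((*) s ^^ n) s * omega t = ((*) s ^^ n) s" for n
    by (induction n) (simp_all add: * mult.assoc)
  then show ?thesis
    using omega_in[of s] unfolding pos_powers_def by auto
qed

lemma equiv_sim: "equiv UNIV (sim :: ('a::lrbg \<times> 'a) set)"
proof (rule equivI)
  show "sim \<subseteq> UNIV \<times> (UNIV :: 'a set)" by simp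
  show "refl (sim :: ('a \<times> 'a) set)"
    by (simp add: refl_on_def sim_def omega_mult_self)
  show "sym (sim :: ('a \<times> 'a) set)" by (auto simp: sym_def sim_def)
  show "trans (sim :: ('a \<times> 'a) set)"
  proof (rule transI)
    fix s t u :: 'a
    assume st: "(s, t) \<in> sim" and tu: "(t, u) \<in> sim"
    then have ts: "(t, s) \<in> sim" and ut: "(u, t) \<in> sim" by (auto simp: sim_def)
    have eqs: "omega s * t = s" "omega t * u = t" "omega u * t = u" "omega t * s = t"
      using st tu by (auto simp: sim_def)
    have "omega s * u = s"
      using mult.assoc[of "omega s" "omega t" u] eqs(1,2) sim_omega_mult[OF st] by simp
    moreover have "omega u * s = u"
      using mult.assoc[of "omega u" "omega t" s] eqs(3,4) sim_omega_mult[OF ut] by simp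
    ultimately show "(s, u) \<in> sim" by (simp add: sim_def)
  qed
qed

lemma omega_mult_left: "omega (s * t) * omega s = omega (s * (t::'a::lrbg))"
proof -
  have "((*) (s * t) ^^ n) (s * t) * omega s = ((*) (s * t) ^^ n) (s * t)" for n
    by (induction n) (simp_all add: mult.assoc mult_mult_omega[unfolded mult.assoc])
  then show ?thesis
    using omega_in[of "s * t"] unfolding pos_powers_def by auto
qed

lemma omega_mult_right: "omega (s * t) * s * omega t = omega (s * t) * (s::'a::lrbg)"
proof -
  have "((*) (s * t) ^^ n) (s * t) * s * omega t = ((*) (s * t) ^^ n) (s * t) * s" for n
    by (induction n) (simp_all add: mult.assoc mult_mult_omega[unfolded mult.assoc])
  then show ?thesis
    using omega_in[of "s * t"] unfolding pos_powers_def by auto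
qed

lemma sim_mult:
  assumes "(s, s') \<in> sim" "(t, t') \<in> (sim :: ('a::lrbg \<times> 'a) set)"
  shows "(s * t, s' * t') \<in> sim"
proof -
  have left: "omega (s * t) * (s' * t) = s * t" if "(s, s') \<in> sim" for s s' t :: 'a
  proof -
    have "omega s * s' = s" using that by (simp add: sim_def)
    then have "omega (s * t) * (s' * t) = omega (s * t) * (s * t)"
      using mult.assoc[of "omega (s * t)" "omega s" "s' * t"] mult.assoc[of "omega s" s' t]
      by (simp add: omega_mult_left)
    then show ?thesis by (simp add: omega_mult_self)
  qed
  have right: "omega (s * t) * (s * t') = s * t" if "(t, t') \<in> sim" for s t t' :: 'a
  proof -
    have "omega t * t' = t" using that by (simp add: sim_def)
    then have "omega (s * t) * s * t' = omega (s * t) * s * t"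
      using mult.assoc[of "omega (s * t) * s" "omega t" t'] by (simp add: omega_mult_right)
    then show ?thesis
      using mult.assoc[of "omega (s * t)" s] by (simp add: omega_mult_self)
  qed
  have sym: "(s', s) \<in> sim" "(t', t) \<in> sim" using assms by (auto simp: sim_def)
  have "(s * t, s' * t) \<in> sim"
    using left[OF assms(1)] left[OF sym(1)] by (simp add: sim_def)
  moreover have "(s' * t, s' * t') \<in> sim"
    using right[OF assms(2)] right[OF sym(2)] by (simp add: sim_def)
  ultimately show ?thesis
    using equiv_sim by (meson equivE transE)
qed

lemma T_mult_supp: "T_mult (supp s) (supp t) = supp (s * (t::'a::lrbg))"
proof -
  have "supp (s' * t') = supp (s * t)" if "s' \<in> supp s" "t' \<in> supp t" for s' t'
    using that sim_mult equiv_class_eq[OF equiv_sim] unfolding supp_def by fastforce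
  moreover have "s \<in> supp s" "t \<in> supp t"
    by (simp_all add: supp_def sim_def omega_mult_self)
  ultimately show ?thesis unfolding T_mult_def by blast
qed


section \<open>The semigroup algebra over the complex numbers\<close>

text \<open>An element is given by its coefficient function. No multiplicative unit is built in,
  since the semigroup need not be a monoid.\<close>

typedef 'a salg = "UNIV :: ('a \<Rightarrow> complex) set"
  morphisms coeff Abs_salg ..

setup_lifting type_definition_salg

lemma salg_eqI: "(\<And>s. coeff a s = coeff b s) \<Longrightarrow> a = b"
  by transfer auto

instantiation salg :: (type) ab_group_add
begin
lift_definition zero_salg :: "'a salg" is "\<lambda>_. 0" .
lift_definition plus_salg :: "'a salg \<Rightarrow> 'a salg \<Rightarrow> 'a salg" is "\<lambda>f g s. f s + g s" .
lift_definition minus_salg :: "'a salg \<Rightarrow> 'a salg \<Rightarrow> 'a salg" is "\<lambda>f g s. f s - g s" .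
lift_definition uminus_salg :: "'a salg \<Rightarrow> 'a salg" is "\<lambda>f s. - f s" .
instance by standard (transfer; simp add: fun_eq_iff algebra_simps)+
end

instantiation salg :: ("{semigroup_mult,finite}") ring
begin
lift_definition times_salg :: "'a salg \<Rightarrow> 'a salg \<Rightarrow> 'a salg"
  is "\<lambda>f g u. \<Sum>(s, t) \<in> {(s, t). s * t = u}. f s * g t" .
instance
proof
  fix a b c :: "'a salg"
  show "a * b * c = a * (b * c)"
  proof (transfer, rule ext)
    fix f g h :: "'a \<Rightarrow> complex" and u :: 'a
    have "(\<Sum>(s, t) \<in> {(s, t). s * t = u}. (\<Sum>(p, q) \<in> {(p, q). p * q = s}. f p * g q) * h t)
        = (\<Sum>((s, t), (p, q)) \<in> Sigma {(s, t). s * t = u} (\<lambda>(s, t). {(p, q). p * q = s}).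
            f p * g q * h t)"
      by (subst sum.Sigma[symmetric]) (simp_all add: sum_distrib_right case_prod_unfold)
    also have "\<dots> = (\<Sum>((s, t), (p, q)) \<in> Sigma {(s, t). s * t = u} (\<lambda>(s, t). {(p, q). p * q = t}).
            f s * (g p * h q))"
      by (rule sum.reindex_bij_witness[where
            i = "\<lambda>((s, t), (p, q)). ((s * p, q), (s, p))" and
            j = "\<lambda>((s, t), (p, q)). ((p, q * t), (q, t))"])
        (auto simp: mult.assoc)
    also have "\<dots> = (\<Sum>(s, t) \<in> {(s, t). s * t = u}. f s * (\<Sum>(p, q) \<in> {(p, q). p * q = t}. g p * h q))"
      by (subst sum.Sigma[symmetric]) (simp_all add: sum_distrib_left case_prod_unfold)
    finally show "(\<Sum>(s, t) \<in> {(s, t). s * t = u}. (\<Sum>(p, q) \<in> {(p, q). p * q = s}. f p * g q) * h t)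
        = (\<Sum>(s, t) \<in> {(s, t). s * t = u}. f s * (\<Sum>(p, q) \<in> {(p, q). p * q = t}. g p * h q))" .
  qed
  show "(a + b) * c = a * c + b * c"
    by transfer (simp add: fun_eq_iff case_prod_unfold distrib_right sum.distrib)
  show "a * (b + c) = a * b + a * c"
    by transfer (simp add: fun_eq_iff case_prod_unfold distrib_left sum.distrib)
qed
end

lift_definition scale_salg :: "complex \<Rightarrow> 'a salg \<Rightarrow> 'a salg" is "\<lambda>c f s. c * f s" .

global_interpretation salg: vector_space "scale_salg :: complex \<Rightarrow> 'a salg \<Rightarrow> 'a salg"
  by standard (transfer; simp add: fun_eq_iff algebra_simps)+

lift_definition H :: "'a \<Rightarrow> 'a salg" is "\<lambda>s t. if t = s then 1 else 0" .

lemma H_mult: "H s * H t = H (s * (t::'a::{semigroup_mult,finite}))"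
proof (transfer, rule ext)
  fix s t u :: 'a
  have "(\<Sum>(p, q) \<in> {(p, q). p * q = u}. (if p = s then 1 else 0) * (if q = t then 1 else 0))
      = (\<Sum>x \<in> {(p, q). p * q = u}. if x = (s, t) then 1 else (0::complex))"
    by (rule sum.cong) (auto split: if_splits)
  then show "(\<Sum>(p, q) \<in> {(p, q). p * q = u}. (if p = s then 1 else 0) * (if q = t then 1 else 0))
      = (if u = s * t then 1 else (0::complex))"
    by auto
qed

abbreviation C_span :: "'a set \<Rightarrow> 'a salg set" where
  "C_span B \<equiv> salg.span (H ` B)"

lemma C_span_UNIV: "C_span (UNIV :: 'a::finite set) = UNIV"
proof -
  have "a = (\<Sum>s\<in>UNIV. scale_salg (coeff a s) (H s))" for a :: "'a salg"
  proof (rule salg_eqI)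
    fix t
    have "coeff (\<Sum>s\<in>A. scale_salg (coeff a s) (H s)) t
        = (\<Sum>s\<in>A. if s = t then coeff a s else 0)" if "finite A" for A
      using that
      by induction (auto simp: zero_salg.rep_eq plus_salg.rep_eq scale_salg.rep_eq H.rep_eq)
    from this[of UNIV] show "coeff a t = coeff (\<Sum>s\<in>UNIV. scale_salg (coeff a s) (H s)) t"
      by simp
  qed
  moreover have "(\<Sum>s\<in>UNIV. scale_salg (coeff a s) (H s)) \<in> C_span UNIV" for a :: "'a salg"
    by (intro salg.span_sum salg.span_scale salg.span_base) simp
  ultimately show ?thesis by (metis UNIV_eq_I)
qed


section \<open>Complete systems of primitive orthogonal idempotents\<close>

text \<open>Here \<open>A\<close> is the carrier of an algebra inside an ambient ring.  Its unit, which may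
  differ from a unit of the ambient ring, is not a parameter: it is determined by \<open>A\<close>.\<close>

definition is_unity :: "'r::ring set \<Rightarrow> 'r \<Rightarrow> bool" where
  "is_unity A u \<longleftrightarrow> u \<in> A \<and> (\<forall>a\<in>A. u * a = a \<and> a * u = a)"

definition primitive_idem :: "'r::ring set \<Rightarrow> 'r \<Rightarrow> bool" where
  "primitive_idem A e \<longleftrightarrow> e \<in> A \<and> e * e = e \<and> e \<noteq> 0 \<and>
     \<not> (\<exists>f\<in>A. \<exists>g\<in>A. f \<noteq> 0 \<and> g \<noteq> 0 \<and> f * f = f \<and> g * g = g \<and>
           f * g = 0 \<and> g * f = 0 \<and> e = f + g)"

definition CSoPOI :: "'r::ring set \<Rightarrow> 'i set \<Rightarrow> ('i \<Rightarrow> 'r) \<Rightarrow> bool" where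
  "CSoPOI A I e \<longleftrightarrow> finite I \<and> (\<forall>i\<in>I. primitive_idem A (e i)) \<and>
     (\<forall>i\<in>I. \<forall>j\<in>I. e i * e j = (if i = j then e i else 0)) \<and>
     is_unity A (\<Sum>i\<in>I. e i)"


section \<open>Homogeneous sections\<close>

definition homogeneous_section :: "('a::lrbg set \<Rightarrow> 'a salg) \<Rightarrow> bool" where
  "homogeneous_section u \<longleftrightarrow> (\<forall>X\<in>E_T. \<exists>c :: 'a \<Rightarrow> complex.
     u X = (\<Sum>x | x \<in> E_S \<and> supp x = X. scale_salg (c x) (H x)) \<and>
     (\<Sum>x | x \<in> E_S \<and> supp x = X. c x) = 1)"

definition arises_from :: "('a::lrbg set \<Rightarrow> 'a salg) \<Rightarrow> ('a set \<Rightarrow> 'a salg) \<Rightarrow> bool" where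
  "arises_from u e \<longleftrightarrow>
     (\<forall>X\<in>E_T. e X = u X - (\<Sum>Y | Y \<in> E_T \<and> T_less X Y. u X * e Y))"

definition indexed_CSoPOI :: "('a::lrbg set \<Rightarrow> 'a salg) \<Rightarrow> bool" where
  "indexed_CSoPOI e \<longleftrightarrow> CSoPOI (C_span E_S) E_T e \<and>
     (\<exists>u. homogeneous_section u \<and> arises_from u e)"

end

(* Cut CS down by e_X = e0 X. For a representative x of X, sending s to xs if supp s <= X and to 0
   otherwise extends to an algebra homomorphism p from CS onto CG_x with p(e_X) = x. Downward
   induction on X shows that w e_X = 0 unless supp w <= X; hence x a e_X = p(a) e_X for every a,
   and with e_X = u_X e_X and u_X = u_X x this gives e_X a e_X = e_X p(a) e_X. So p restricts to an
   isomorphism of the corner e_X CS e_X with CG_x, with inverse b |-> e_X b e_X, under which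
   primitive orthogonal idempotents correspond. *)
theory Submission
  imports Defs
begin

section \<open>Left regular bands of groups\<close>

lemma omega_eqI:
  fixes s :: "'a::{semigroup_mult,finite}"
  assumes "e \<in> pos_powers s" "e * e = e"
  shows "omega s = e"
  using omega_ex1[of s] omega_in[of s] omega_idem[of s] assms by blast

lemma omega_E_S: "x \<in> E_S \<Longrightarrow> omega x = x"
proof (rule omega_eqI)
  show "x \<in> pos_powers x" unfolding pos_powers_def by (rule range_eqI[of _ _ 0]) simp
qed (simp add: E_S_def)

lemma omega_in_E_S: "omega s \<in> E_S"
  by (simp add: E_S_def omega_idem)

lemma E_S_idem: "x \<in> E_S \<Longrightarrow> x * x = x"
  by (simp add: E_S_def)

text \<open>The axiom \<open>mult_mult_omega\<close> at an idempotent. Here \<open>s\<close> is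
  arbitrary, so this goes beyond left regularity of the band \<open>E_S\<close>.\<close>

lemma E_S_left_regular: "x \<in> E_S \<Longrightarrow> x * (s * x) = x * s"
  using mult_mult_omega[of x s] by (simp add: omega_E_S mult.assoc)

lemma E_S_mult:
  assumes "x \<in> E_S" "y \<in> E_S"
  shows "x * y \<in> E_S"
proof -
  have "x * y * (x * y) = x * (y * x) * y" by (simp add: mult.assoc)
  also have "\<dots> = x * y"
    using assms by (simp add: E_S_left_regular E_S_idem mult.assoc)
  finally show ?thesis by (simp add: E_S_def)
qed

lemma ex_omega_inverse:
  fixes s :: "'a::{semigroup_mult,finite}"
  shows "\<exists>r. r * s = omega s \<and> s * r = omega s"
proof -
  obtain n where n: "omega s = ((*) s ^^ n) s"
    using omega_in[of s] unfolding pos_powers_def by auto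
  \<comment> \<open>Squaring leaves a positive power after one factor \<open>s\<close> is split off,
    even when \<open>n = 0\<close>.\<close>
  have "omega s = ((*) s ^^ (n + n + 1)) s"
    using omega_idem[of s] unfolding n by (simp add: spow_add)
  then have "((*) s ^^ (n + n)) s * s = omega s" "s * ((*) s ^^ (n + n)) s = omega s"
    using spow_add[of "n + n" s 0] spow_add[of 0 s "n + n"] by simp_all
  then show ?thesis by blast
qed

text \<open>If \<open>r\<close> inverts \<open>s\<close>, then \<open>x * r\<close> is a right
  inverse of \<open>x * s\<close> relative to \<open>x\<close>; multiplying
  \<open>omega (x * s) * (x * s) = x * s\<close> by it gives the claim. Thus
  \<open>s \<mapsto> x * s\<close> lands in the group \<open>G_S x\<close>.\<close>

lemma omega_mult_eq:
  assumes x: "x \<in> E_S" and s: "x * omega s = x"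
  shows "omega (x * s) = x"
proof -
  obtain r where r: "s * r = omega s" using ex_omega_inverse by blast
  have "(x * s) * (x * r) = x * (s * x) * r" by (simp add: mult.assoc)
  also have "\<dots> = x" using r s by (simp add: E_S_left_regular[OF x] mult.assoc)
  finally have inv: "(x * s) * (x * r) = x" .
  have "omega (x * s) = omega (x * s) * x"
    using omega_mult_left[of x s] by (simp add: omega_E_S[OF x])
  also have "\<dots> = x"
    using arg_cong[OF omega_mult_self[of "x * s"], of "\<lambda>t. t * (x * r)"] inv
    by (simp only: mult.assoc)
  finally show ?thesis .
qed

section \<open>Supports of idempotents and their order\<close>

lemma supp_eq_iff:
  assumes "x \<in> E_S" "y \<in> E_S"
  shows "supp x = supp y \<longleftrightarrow> x * y = x \<and> y * x = y"
proof -
  have "supp x = supp y \<longleftrightarrow> (x, y) \<in> sim"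
    unfolding supp_def using equiv_class_eq_iff[OF equiv_sim, of x y] by simp
  then show ?thesis using assms by (simp add: sim_def omega_E_S)
qed

text \<open>Of the two equations given by \<open>supp_eq_iff\<close>, one always holds and the
  other, \<open>y * (x * y) = y\<close>, collapses by left regularity.\<close>

lemma T_le_supp_iff:
  assumes "x \<in> E_S" "y \<in> E_S"
  shows "T_le (supp x) (supp y) \<longleftrightarrow> y * x = y"
  unfolding T_le_def T_mult_supp supp_eq_iff[OF E_S_mult[OF assms] assms(2)]
  using assms by (simp add: E_S_idem E_S_left_regular mult.assoc)

lemma T_le_trans:
  assumes "X \<in> E_T" "Y \<in> E_T" "Z \<in> E_T" "T_le X Y" "T_le Y Z"
  shows "T_le X Z"
  using assms unfolding E_T_def by (auto simp: T_le_supp_iff) (metis mult.assoc)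

lemma T_le_refl: "X \<in> E_T \<Longrightarrow> T_le X X"
  unfolding E_T_def by (auto simp: T_le_supp_iff E_S_idem)

lemma T_le_antisym: "X \<in> E_T \<Longrightarrow> Y \<in> E_T \<Longrightarrow> T_le X Y \<Longrightarrow> T_le Y X \<Longrightarrow> X = Y"
  unfolding E_T_def using supp_eq_iff by (fastforce simp: T_le_supp_iff)

text \<open>The elements with \<open>x * omega s = x\<close> are closed under products and their
  complement is an ideal. This is what makes \<open>group_proj\<close> multiplicative.\<close>

lemma mult_omega_mult_iff:
  assumes x: "x \<in> E_S"
  shows "x * omega (s * t) = x \<longleftrightarrow> x * omega s = x \<and> x * omega t = x"
proof
  assume st: "x * omega (s * t) = x"
  have s: "x * omega s = x" by (metis st omega_mult_left mult.assoc)
  \<comment> \<open>\<open>x * s\<close> lies in the group with identity \<open>x\<close>; its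
    inverse \<open>r\<close> will cancel it from the left.\<close>
  obtain r where r: "r * (x * s) = x"
    using ex_omega_inverse[of "x * s"] unfolding omega_mult_eq[OF x s] by blast
  have "x * s * omega t = x * (omega (s * t) * s * omega t)"
    by (simp add: st mult.assoc[symmetric])
  also have "\<dots> = x * s" unfolding omega_mult_right by (simp add: st mult.assoc[symmetric])
  finally have "r * (x * s * omega t) = r * (x * s)" by simp
  then have "x * omega t = x" using r by (simp add: mult.assoc[symmetric])
  with s show "x * omega s = x \<and> x * omega t = x" by simp
next
  assume *: "x * omega s = x \<and> x * omega t = x"
  obtain r where r: "r * (x * s) = x"
    using ex_omega_inverse[of "x * s"] omega_mult_eq[OF x, of s] * by auto
  obtain q where q: "q * (x * t) = x"
    using ex_omega_inverse[of "x * t"] omega_mult_eq[OF x, of t] * by auto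
  \<comment> \<open>A left inverse of \<open>x * (s * t)\<close> turns
    \<open>s * t * omega (s * t) = s * t\<close> into the claim.\<close>
  have "(q * r) * (x * (s * t)) = q * (r * (x * (s * x)) * t)"
    by (simp add: E_S_left_regular[OF x] mult.assoc)
  also have "\<dots> = q * ((r * (x * s)) * x * t)" by (simp add: mult.assoc)
  also have "\<dots> = x" using q by (simp add: r E_S_idem[OF x])
  finally have "(q * r) * (x * (s * t)) = x" .
  then have "x * omega (s * t) = (q * r) * x * (s * t * omega (s * t))"
    by (simp only: mult.assoc[symmetric])
  also have "\<dots> = x"
    using \<open>(q * r) * (x * (s * t)) = x\<close> by (simp add: mult_omega_self mult.assoc)
  finally show "x * omega (s * t) = x" .
qed


section \<open>The homomorphism onto a maximal subgroup algebra\<close>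

lemma scale_salg_mult_left:
  "scale_salg c a * b = scale_salg c (a * (b :: 'a::{semigroup_mult,finite} salg))"
  by transfer (simp add: fun_eq_iff sum_distrib_left case_prod_unfold mult.assoc)

lemma scale_salg_mult_right:
  "a * scale_salg c b = scale_salg c (a * (b :: 'a::{semigroup_mult,finite} salg))"
  by transfer (simp add: fun_eq_iff sum_distrib_left case_prod_unfold mult.left_commute)

lemma C_span_induct [consumes 1, case_names zero step]:
  assumes "a \<in> C_span B" "P 0"
    and "\<And>c s b. s \<in> B \<Longrightarrow> P b \<Longrightarrow> P (scale_salg c (H s) + b)"
  shows "P a"
  using assms(1)
proof (induction rule: salg.span_induct_alt)
  case base
  show ?case by (rule assms(2))
next
  case (step c h b)
  then show ?case using assms(3) by blast
qed

lemma salg_induct [case_names zero step]: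
  fixes a :: "'a::finite salg"
  assumes "P 0" "\<And>c s b. P b \<Longrightarrow> P (scale_salg c (H s) + b)"
  shows "P a"
  using C_span_induct[of a UNIV P] assms by (simp add: C_span_UNIV)

text \<open>The map \<open>p\<close> of the overview. For idempotent \<open>x\<close> the summation
  condition says that the support of \<open>omega s\<close> is at most that of
  \<open>x\<close>.\<close>

definition group_proj :: "'a::lrbg \<Rightarrow> 'a salg \<Rightarrow> 'a salg" where
  "group_proj x a = (\<Sum>s | x * omega s = x. scale_salg (coeff a s) (H (x * s)))"

lemma group_proj_add: "group_proj x (a + b) = group_proj x a + group_proj x b"
  by (simp add: group_proj_def plus_salg.rep_eq salg.scale_left_distrib sum.distrib)

lemma group_proj_scale: "group_proj x (scale_salg c a) = scale_salg c (group_proj x a)"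
  by (simp add: group_proj_def scale_salg.rep_eq salg.scale_sum_right)

lemma linear_group_proj: "Vector_Spaces.linear scale_salg scale_salg (group_proj x)"
  by (simp add: Vector_Spaces.linear_iff salg.vector_space_axioms group_proj_add group_proj_scale)

lemma group_proj_0: "group_proj x 0 = 0"
  by (simp add: group_proj_def zero_salg.rep_eq)

lemma group_proj_diff: "group_proj x (a - b) = group_proj x a - group_proj x b"
  by (simp add: group_proj_def minus_salg.rep_eq salg.scale_left_diff_distrib sum_subtractf)

lemma group_proj_sum: "group_proj x (\<Sum>i\<in>J. f i) = (\<Sum>i\<in>J. group_proj x (f i))"
  by (induction J rule: infinite_finite_induct) (simp_all add: group_proj_0 group_proj_add)

lemma group_proj_H: "group_proj x (H s) = (if x * omega s = x then H (x * s) else 0)"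
proof -
  have "group_proj x (H s) = (\<Sum>t | x * omega t = x. if t = s then H (x * s) else 0)"
    unfolding group_proj_def by (rule sum.cong) (simp_all add: H.rep_eq)
  then show ?thesis by simp
qed

text \<open>On basis elements both sides vanish together by \<open>mult_omega_mult_iff\<close>;
  otherwise \<open>x * s * (x * t) = x * (s * t)\<close> by left regularity.\<close>

lemma group_proj_mult:
  assumes x: "x \<in> E_S"
  shows "group_proj x (a * b) = group_proj x a * group_proj x b"
proof -
  have HH: "group_proj x (H s * H t) = group_proj x (H s) * group_proj x (H t)" for s t
    using mult_omega_mult_iff[OF x, of s t] E_S_left_regular[OF x, of s]
    by (simp add: H_mult group_proj_H) (metis mult.assoc)
  have "group_proj x (H s * b) = group_proj x (H s) * group_proj x b" for s
    by (induction b rule: salg_induct)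
      (simp_all add: group_proj_0 distrib_left group_proj_add group_proj_scale
        scale_salg_mult_right HH)
  then show ?thesis
    by (induction a rule: salg_induct)
      (simp_all add: group_proj_0 distrib_right group_proj_add group_proj_scale
        scale_salg_mult_left)
qed

lemma group_proj_in_span:
  assumes "x \<in> E_S"
  shows "group_proj x a \<in> C_span (G_S x)"
  unfolding group_proj_def
  by (intro salg.span_sum salg.span_scale salg.span_base)
    (use omega_mult_eq[OF assms] in \<open>auto simp: G_S_def\<close>)

lemma group_proj_eq_self:
  assumes x: "x \<in> E_S" and "a \<in> C_span (G_S x)"
  shows "group_proj x a = a"
  using assms(2)
proof (induction rule: C_span_induct)
  case (step c s b)
  then have "omega s = x" by (simp add: G_S_def)
  then have "x * omega s = x" "x * s = s" using omega_mult_self[of s] by (auto simp: E_S_idem[OF x])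
  with step show ?case by (simp add: group_proj_add group_proj_scale group_proj_H)
qed (rule group_proj_0)

lemma H_in_group_span: "x \<in> E_S \<Longrightarrow> H x \<in> C_span (G_S x)"
  by (intro salg.span_base) (simp add: G_S_def omega_E_S)

lemma H_mult_group_span:
  assumes x: "x \<in> E_S" and "a \<in> C_span (G_S x)"
  shows "H x * a = a" "a * H x = a"
  using assms(2)
proof (induction rule: C_span_induct)
  case (step c s b)
  then have "x * s = s" "s * x = s"
    using omega_mult_self[of s] mult_omega_self[of s] by (auto simp: G_S_def)
  moreover case 1
  ultimately show ?case using step by (simp add: distrib_left scale_salg_mult_right H_mult)
next
  case (step c s b)
  then have "x * s = s" "s * x = s"
    using omega_mult_self[of s] mult_omega_self[of s] by (auto simp: G_S_def)
  moreover case 2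
  ultimately show ?case using step by (simp add: distrib_right scale_salg_mult_left H_mult)
qed simp_all

section \<open>Units of the algebras\<close>

lemma unity_group_span:
  assumes "x \<in> E_S" "is_unity (C_span (G_S x)) u"
  shows "u = H x"
  using assms H_mult_group_span(2)[of x u] H_in_group_span[of x]
  by (auto simp: is_unity_def)

text \<open>Every \<open>H s\<close> absorbs \<open>H (omega s)\<close> on both sides, so a unit of
  the idempotent algebra acts as a unit on all of the semigroup algebra.\<close>

lemma H_mult_unity_E_S:
  assumes "is_unity (C_span E_S) u"
  shows "H s * u = H s" "u * H s = H s"
proof -
  have "H (omega s) \<in> C_span E_S"
    by (intro salg.span_base) (simp add: omega_in_E_S)
  then have u: "H (omega s) * u = H (omega s)" "u * H (omega s) = H (omega s)"
    using assms by (simp_all add: is_unity_def)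
  have s: "H s = H s * H (omega s)" "H s = H (omega s) * H s"
    by (simp_all add: H_mult mult_omega_self omega_mult_self)
  show "H s * u = H s" by (metis s(1) u(1) mult.assoc)
  show "u * H s = H s" by (metis s(2) u(2) mult.assoc)
qed

lemma is_unity_C_span_UNIV:
  fixes u :: "'a::lrbg salg"
  assumes "is_unity (C_span E_S) u"
  shows "is_unity (C_span UNIV) u"
proof -
  have "u * a = a \<and> a * u = a" for a
    by (induction a rule: salg_induct)
      (simp_all add: H_mult_unity_E_S[OF assms] distrib_left distrib_right
        scale_salg_mult_left scale_salg_mult_right)
  then show ?thesis by (simp add: is_unity_def C_span_UNIV)
qed


section \<open>Homogeneous sections\<close>

text \<open>\<open>u X\<close> is an affine combination of the \<open>H z\<close> with
  \<open>z\<close> of support \<open>X\<close>, so a linear map that is constant on these takes the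
  same value at \<open>u X\<close>.\<close>

lemma linear_homogeneous_section:
  assumes u: "homogeneous_section u" and X: "X \<in> E_T"
    and f: "Vector_Spaces.linear scale_salg scale_salg f"
    and b: "\<And>z. z \<in> E_S \<Longrightarrow> supp z = X \<Longrightarrow> f (H z) = b"
  shows "f (u X) = b"
proof -
  interpret f: Vector_Spaces.linear scale_salg scale_salg f by (rule f)
  obtain c where c: "u X = (\<Sum>x | x \<in> E_S \<and> supp x = X. scale_salg (c x) (H x))"
    "(\<Sum>x | x \<in> E_S \<and> supp x = X. c x) = 1"
    using u X unfolding homogeneous_section_def by blast
  have "f (u X) = (\<Sum>x | x \<in> E_S \<and> supp x = X. scale_salg (c x) b)"
    unfolding c(1) f.sum f.scale by (rule sum.cong) (simp_all add: b)
  also have "\<dots> = b" by (simp add: salg.scale_sum_left[symmetric] c(2))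
  finally show ?thesis .
qed

lemma linear_mult_left: "Vector_Spaces.linear scale_salg scale_salg ((*) (a :: 'a::lrbg salg))"
  by (simp add: Vector_Spaces.linear_iff salg.vector_space_axioms distrib_left
      scale_salg_mult_right)

lemma H_mult_section:
  assumes "homogeneous_section u" "y \<in> E_S"
  shows "H y * u (supp y) = H y"
  by (rule linear_homogeneous_section[OF assms(1) _ linear_mult_left])
    (use assms in \<open>auto simp: E_T_def H_mult supp_eq_iff\<close>)

lemma section_mult_H:
  assumes "homogeneous_section u" "y \<in> E_S"
  shows "u (supp y) * H y = u (supp y)"
proof -
  \<comment> \<open>\<open>H z * H y = H z\<close> varies with \<open>z\<close>, so the
    constant-value argument is applied to the difference, which is always 0.\<close>
  let ?f = "\<lambda>b. b * H y - b"
  have "Vector_Spaces.linear scale_salg scale_salg ?f"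
    by (simp add: Vector_Spaces.linear_iff salg.vector_space_axioms distrib_right
      scale_salg_mult_left salg.scale_right_diff_distrib)
  from linear_homogeneous_section[OF assms(1) _ this, of "supp y" 0] assms
  show ?thesis by (auto simp: E_T_def H_mult supp_eq_iff)
qed

lemma section_idem:
  assumes "homogeneous_section u" "X \<in> E_T"
  shows "u X * u X = u X"
  by (rule linear_homogeneous_section[OF assms linear_mult_left])
    (use section_mult_H[OF assms(1)] in blast)

lemma arises_fromD:
  assumes "arises_from u e" "X \<in> E_T"
  shows "e X = u X - (\<Sum>Y | Y \<in> E_T \<and> T_less X Y. u X * e Y)"
  using assms unfolding arises_from_def by blast

lemma section_mult_arises:
  assumes "homogeneous_section u" "arises_from u e" "X \<in> E_T"
  shows "u X * e X = e X"
proof -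
  show ?thesis
    unfolding arises_fromD[OF assms(2,3)]
    by (simp add: right_diff_distrib section_idem[OF assms(1,3)] sum_distrib_left
        mult.assoc[symmetric])
qed

text \<open>Induction on the number of classes strictly above \<open>supp x\<close>. For
  \<open>z\<close> of support \<open>supp x\<close>, the product \<open>w * z\<close> has strictly
  larger support, and there the recursion and the induction hypothesis show that the two terms of
  \<open>f (H z)\<close> below cancel.\<close>

lemma H_mult_arises_eq_0:
  fixes x w :: "'a::lrbg"
  assumes u: "homogeneous_section u" and e: "arises_from u e"
    and "x \<in> E_S" "w \<in> E_S" "x * w \<noteq> x"
  shows "H w * e (supp x) = 0"
  using assms(3-)
proof (induction "card {Y \<in> E_T. T_less (supp x) Y}" arbitrary: x w rule: less_induct)
  case less
  note x = \<open>x \<in> E_S\<close> and w = \<open>w \<in> E_S\<close>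
  define X where "X = supp x"
  have X: "X \<in> E_T" using x by (simp add: X_def E_T_def)
  \<comment> \<open>Chosen so that the recursion for \<open>e X\<close> reads
    \<open>f (u X) = H w * e X\<close>; it then suffices to kill each \<open>H z\<close>.\<close>
  define f where "f a = H w * a - (\<Sum>Y | Y \<in> E_T \<and> T_less X Y. H w * a * e Y)" for a
  have lin: "Vector_Spaces.linear scale_salg scale_salg f"
    by (simp add: Vector_Spaces.linear_iff salg.vector_space_axioms f_def distrib_left distrib_right
        sum.distrib scale_salg_mult_left scale_salg_mult_right salg.scale_right_diff_distrib
        salg.scale_sum_right)
  have "f (H z) = 0" if z: "z \<in> E_S" "supp z = X" for z
  proof -
    define v where "v = w * z"
    have v: "v \<in> E_S" using w z by (simp add: v_def E_S_mult)
    define Z where "Z = supp v"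
    have Z: "Z \<in> E_T" using v by (simp add: Z_def E_T_def)
    have "T_le X Z"
      unfolding Z_def z(2)[symmetric] T_le_supp_iff[OF z(1) v]
      by (simp add: v_def mult.assoc E_S_idem z)
    moreover have "X \<noteq> Z"
    proof
      assume "X = Z"
      \<comment> \<open>Equal supports would give
        \<open>x * w = x * (w * z * w) = x * (w * z) = x\<close>.\<close>
      then have xv: "x * v = x" unfolding X_def Z_def using x v by (simp add: supp_eq_iff)
      then have "x * w = x * (w * (z * w))" by (simp add: v_def mult.assoc[symmetric])
      also have "\<dots> = x" using xv by (simp add: v_def E_S_left_regular[OF w])
      finally show False using less.prems by simp
    qed
    ultimately have XZ: "T_less X Z" by (simp add: T_less_def)
    have up: "T_less X Y" if "Y \<in> E_T" "T_le Z Y" for Y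
      using that XZ X Z T_le_trans[of X Z Y] T_le_antisym[of X Z] by (auto simp: T_less_def)
    have vanish: "H v * e Y = 0" if Y: "Y \<in> E_T" "T_less X Y" "\<not> T_le Z Y" for Y
    proof -
      obtain y where y: "y \<in> E_S" "Y = supp y" using Y(1) by (auto simp: E_T_def)
      have "{W \<in> E_T. T_less Y W} \<subset> {W \<in> E_T. T_less X W}"
        using Y X T_le_trans[of X Y] T_le_antisym[of X Y] unfolding T_less_def by blast
      then have "card {W \<in> E_T. T_less Y W} < card {W \<in> E_T. T_less X W}"
        by (intro psubset_card_mono) simp_all
      moreover have "y * v \<noteq> y" using Y(3) y v by (simp add: Z_def T_le_supp_iff)
      ultimately show ?thesis using less.hyps[of y v] y v by (simp add: X_def)
    qed
    \<comment> \<open>Since \<open>H v * u Z = H v\<close>, the recursion at \<open>Z\<close>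
      expands \<open>H v\<close> over all \<open>e Y\<close> with \<open>Y\<close> at or above
      \<open>Z\<close>.\<close>
    have "H v * e Z = H v - (\<Sum>Y | Y \<in> E_T \<and> T_less Z Y. H v * e Y)"
      unfolding arises_fromD[OF e Z]
      by (simp add: right_diff_distrib sum_distrib_left mult.assoc[symmetric]
          H_mult_section[OF u v, folded Z_def])
    then have "H v = H v * e Z + (\<Sum>Y | Y \<in> E_T \<and> T_less Z Y. H v * e Y)"
      by simp
    also have "\<dots> = (\<Sum>Y\<in>insert Z {Y \<in> E_T. T_less Z Y}. H v * e Y)"
      by (subst sum.insert) (simp_all add: T_less_def)
    \<comment> \<open>The added terms, with \<open>Y\<close> above \<open>X\<close> but not above
      \<open>Z\<close>, are zero by \<open>vanish\<close>.\<close>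
    also have "\<dots> = (\<Sum>Y | Y \<in> E_T \<and> T_less X Y. H v * e Y)"
      by (rule sum.mono_neutral_left)
        (use Z up vanish T_le_refl in \<open>auto simp: T_less_def\<close>)
    finally show ?thesis by (simp add: f_def H_mult v_def)
  qed
  then have "f (u X) = 0" by (rule linear_homogeneous_section[OF u X lin])
  moreover have "f (u X) = H w * e X"
    unfolding arises_fromD[OF e X] by (simp add: f_def right_diff_distrib sum_distrib_left mult.assoc)
  ultimately show ?case by (simp add: X_def)
qed

section \<open>The corner cut out by \<open>e (supp x)\<close>\<close>

lemma group_proj_section:
  assumes u: "homogeneous_section u" and x: "x \<in> E_S" and Y: "Y \<in> E_T"
  shows "group_proj x (u Y) = (if T_le Y (supp x) then H x else 0)"
  by (rule linear_homogeneous_section[OF u Y linear_group_proj])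
    (use x in \<open>auto simp: group_proj_H T_le_supp_iff omega_E_S\<close>)

text \<open>For \<open>Y\<close> strictly above \<open>supp x\<close> the map kills
  \<open>u Y\<close>, hence also \<open>e Y = u Y * e Y\<close>, so only the leading term of the
  recursion survives.\<close>

lemma group_proj_arises:
  assumes u: "homogeneous_section u" and e: "arises_from u e" and x: "x \<in> E_S"
  shows "group_proj x (e (supp x)) = H x"
proof -
  have X: "supp x \<in> E_T" using x by (simp add: E_T_def)
  have "group_proj x (e Y) = 0" if Y: "Y \<in> E_T" "T_less (supp x) Y" for Y
  proof -
    have "\<not> T_le Y (supp x)" using Y X T_le_antisym by (auto simp: T_less_def)
    then have "group_proj x (u Y * e Y) = 0"
      by (simp add: group_proj_mult[OF x] group_proj_section[OF u x Y(1)])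
    then show ?thesis by (simp add: section_mult_arises[OF u e Y(1)])
  qed
  then show ?thesis
    unfolding arises_fromD[OF e X]
    using T_le_refl[OF X]
    by (simp add: group_proj_diff group_proj_sum group_proj_mult[OF x]
        group_proj_section[OF u x X])
qed

text \<open>Basis elements discarded by \<open>group_proj\<close> annihilate
  \<open>e (supp x)\<close>; on the others both sides agree by definition.\<close>

lemma H_mult_mult_arises:
  assumes u: "homogeneous_section u" and e: "arises_from u e" and x: "x \<in> E_S"
  shows "H x * a * e (supp x) = group_proj x a * e (supp x)"
proof (induction a rule: salg_induct)
  case (step c s b)
  have "H x * H s * e (supp x) = group_proj x (H s) * e (supp x)"
  proof (cases "x * omega s = x")
    case False
    \<comment> \<open>The vanishing lemma needs an idempotent factor next to
      \<open>e (supp x)\<close>.\<close>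
    have "H s = H s * H (omega s)" by (simp add: H_mult mult_omega_self)
    then have "H s * e (supp x) = 0"
      by (metis H_mult_arises_eq_0[OF u e x omega_in_E_S False] mult.assoc mult_zero_right)
    then show ?thesis using False by (simp add: group_proj_H mult.assoc)
  qed (simp add: group_proj_H H_mult)
  with step show ?case
    by (simp add: distrib_left distrib_right group_proj_add group_proj_scale scale_salg_mult_left
        scale_salg_mult_right)
qed (simp add: group_proj_0)

lemma corner_eq:
  assumes u: "homogeneous_section u" and e: "arises_from u e" and x: "x \<in> E_S"
  shows "e (supp x) * a * e (supp x) = e (supp x) * group_proj x a * e (supp x)"
proof -
  let ?e = "e (supp x)" and ?u = "u (supp x)"
  \<comment> \<open>Writing the left \<open>?e\<close> as \<open>?u * H x * ?e\<close> brings
    \<open>H x\<close> to the front. The result depends on \<open>b\<close> only through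
    \<open>group_proj x b\<close>, and \<open>group_proj\<close> fixes its own values.\<close>
  have *: "?e * b * ?e = ?u * (group_proj x b * ?e)" for b
  proof -
    have "?e * b * ?e = ?u * ?e * b * ?e"
      using section_mult_arises[OF u e, of "supp x"] x by (simp add: E_T_def)
    also have "\<dots> = ?u * H x * ?e * b * ?e"
      by (simp add: section_mult_H[OF u x])
    also have "\<dots> = ?u * (H x * (?e * b) * ?e)" by (simp add: mult.assoc)
    also have "\<dots> = ?u * (H x * group_proj x b * ?e)"
      by (simp add: H_mult_mult_arises[OF u e x] group_proj_mult[OF x] group_proj_arises[OF u e x])
    also have "\<dots> = ?u * (group_proj x b * ?e)"
      by (simp add: H_mult_group_span(1)[OF x group_proj_in_span[OF x]])
    finally show ?thesis .
  qed
  show ?thesis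
    by (simp add: * group_proj_eq_self[OF x group_proj_in_span[OF x]])
qed

section \<open>Transfer of idempotents from the group algebras\<close>

theorem theorem4p3:
  fixes e0 :: "'a::lrbg set \<Rightarrow> 'a salg"
    and x :: "'a set \<Rightarrow> 'a"
    and I :: "'a set \<Rightarrow> 'i set"
    and E :: "'a set \<Rightarrow> 'i \<Rightarrow> 'a salg"
  assumes "indexed_CSoPOI e0"
    and "\<And>X. X \<in> E_T \<Longrightarrow> x X \<in> E_S \<and> supp (x X) = X"
    and "\<And>X. X \<in> E_T \<Longrightarrow> CSoPOI (C_span (G_S (x X))) (I X) (E X)"
  shows "CSoPOI (C_span (UNIV :: 'a set)) (SIGMA X:E_T. I X)
    (\<lambda>(X, i). e0 X * E X i * e0 X)"
proof -
  obtain u where u: "homogeneous_section u" and ar: "arises_from u e0"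
    and e0: "CSoPOI (C_span E_S) E_T e0"
    using assms(1) by (auto simp: indexed_CSoPOI_def)
  have orth: "e0 X * e0 Y = (if X = Y then e0 X else 0)" if "X \<in> E_T" "Y \<in> E_T" for X Y
    using e0 that by (simp add: CSoPOI_def)
  have xE: "x X \<in> E_S" if "X \<in> E_T" for X using assms(2) that by simp
  define p where "p X = group_proj (x X)" for X
  have p_mult: "p X (a * b) = p X a * p X b" if "X \<in> E_T" for X a b
    using group_proj_mult[OF xE[OF that]] by (simp add: p_def)
  have p_span: "p X a \<in> C_span (G_S (x X))" if "X \<in> E_T" for X a
    using group_proj_in_span[OF xE[OF that]] by (simp add: p_def)
  have p_e0: "p X (e0 X) = H (x X)" if "X \<in> E_T" for X
    using group_proj_arises[OF u ar xE[OF that]] assms(2)[OF that] by (simp add: p_def)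
  have corner: "e0 X * a * e0 X = e0 X * p X a * e0 X" if "X \<in> E_T" for X a
    using corner_eq[OF u ar xE[OF that]] assms(2)[OF that] by (simp add: p_def)
  \<comment> \<open>Compressing by \<open>e0 X\<close> is right inverse to \<open>p X\<close> on the
    group algebra, since \<open>p X (e0 X)\<close> is its unit.\<close>
  have p_corner: "p X (e0 X * b * e0 X) = b" if "X \<in> E_T" "b \<in> C_span (G_S (x X))" for X b
    unfolding p_mult[OF that(1)] p_e0[OF that(1)]
    using H_mult_group_span[OF xE[OF that(1)] that(2)] group_proj_eq_self[OF xE[OF that(1)] that(2)]
    by (simp add: p_def)
  have E_prim: "primitive_idem (C_span (G_S (x X))) (E X i)" if "X \<in> E_T" "i \<in> I X" for X i
    using assms(3)[OF that(1)] that(2) by (simp add: CSoPOI_def)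
  have E_orth: "E X i * E X j = (if i = j then E X i else 0)"
    if "X \<in> E_T" "i \<in> I X" "j \<in> I X" for X i j
    using assms(3)[OF that(1)] that(2,3) by (simp add: CSoPOI_def)
  have E_span: "E X i \<in> C_span (G_S (x X))" if "X \<in> E_T" "i \<in> I X" for X i
    using E_prim[OF that] by (simp add: primitive_idem_def)
  have E_sum: "(\<Sum>i\<in>I X. E X i) = H (x X)" if "X \<in> E_T" for X
    using assms(3)[OF that] unity_group_span[OF xE[OF that]] by (simp add: CSoPOI_def)
  define e where "e X i = e0 X * E X i * e0 X" for X i
  have e0_e: "e0 X * e X i = e X i" "e X i * e0 X = e X i" if "X \<in> E_T" for X i
    using orth[OF that that] by (simp_all add: e_def mult.assoc) (simp_all add: mult.assoc[symmetric])
  have p_e: "p X (e X i) = E X i" if "X \<in> E_T" "i \<in> I X" for X i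
    unfolding e_def by (rule p_corner[OF that(1) E_span[OF that]])
  have e_orth: "e X i * e Y j = (if (X, i) = (Y, j) then e X i else 0)"
    if "X \<in> E_T" "Y \<in> E_T" "i \<in> I X" "j \<in> I Y" for X Y i j
  proof (cases "X = Y")
    case True
    \<comment> \<open>The product lies in the corner, so \<open>corner\<close> replaces it by its
      image under \<open>p X\<close>, where the orthogonality of the \<open>E X i\<close>
      applies.\<close>
    have "e X i * e X j = e0 X * (e X i * e X j) * e0 X"
      using e0_e[OF that(1)] by (metis mult.assoc)
    also have "\<dots> = e0 X * (E X i * E X j) * e0 X"
      unfolding corner[OF that(1), of "e X i * e X j"] using that True by (simp add: p_mult p_e)
    finally show ?thesis using that True by (simp add: E_orth e_def)
  next
    case False
    have "e X i * e Y j = e X i * (e0 X * e0 Y) * e Y j"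
      using e0_e that by (metis mult.assoc)
    then show ?thesis using False that by (simp add: orth)
  qed
  have e_prim: "primitive_idem (C_span UNIV) (e X i)" if X: "X \<in> E_T" and i: "i \<in> I X" for X i
    unfolding primitive_idem_def
  proof (intro conjI notI)
    show "e X i \<in> C_span UNIV" by (simp add: C_span_UNIV)
    show "e X i * e X i = e X i" using e_orth[of X X i i] X i by simp
    have "E X i \<noteq> 0" using E_prim[OF X i] by (simp add: primitive_idem_def)
    moreover have p0: "p X 0 = 0" by (simp add: p_def group_proj_0)
    ultimately show "e X i = 0 \<Longrightarrow> False" using p_e[OF X i] by auto
    assume "\<exists>f\<in>C_span UNIV. \<exists>g\<in>C_span UNIV. f \<noteq> 0 \<and> g \<noteq> 0 \<and> f * f = f \<and> g * g = g \<and>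
      f * g = 0 \<and> g * f = 0 \<and> e X i = f + g"
    then obtain f g where fg: "f \<noteq> 0" "g \<noteq> 0" "f * f = f" "g * g = g" "f * g = 0" "g * f = 0"
      "e X i = f + g" by blast
    \<comment> \<open>\<open>p X\<close> is injective on the corner, and both summands of
      \<open>e X i\<close> lie there; a splitting of \<open>e X i\<close> would thus map to one of
      \<open>E X i\<close>.\<close>
    have nz: "p X h \<noteq> 0" if h: "h \<noteq> 0" "e X i * h = h" "h * e X i = h" for h
    proof
      assume "p X h = 0"
      moreover have "h = e0 X * h * e0 X" using e0_e[OF X, of i] h(2,3) by (metis mult.assoc)
      ultimately show False using corner[OF X, of h] h(1) by simp
    qed
    have "p X f \<noteq> 0" "p X g \<noteq> 0"
      by (intro nz; simp add: fg distrib_left distrib_right)+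
    moreover have "E X i = p X f + p X g"
      using p_e[OF X i] by (simp add: fg(7) p_def group_proj_add)
    moreover have "p X f * p X f = p X f" "p X g * p X g = p X g"
      "p X f * p X g = 0" "p X g * p X f = 0"
      using fg p0 by (simp_all add: p_mult[OF X, symmetric])
    ultimately show False
      using E_prim[OF X i] p_span[OF X] unfolding primitive_idem_def by blast
  qed
  have finI: "finite (I X)" if "X \<in> E_T" for X
    using assms(3)[OF that] by (simp add: CSoPOI_def)
  have "(\<Sum>i\<in>I X. e X i) = e0 X" if X: "X \<in> E_T" for X
  proof -
    \<comment> \<open>The \<open>E X i\<close> sum to \<open>H (x X) = p X (e0 X)\<close>, so
      \<open>corner\<close> can be read backwards with \<open>a = e0 X\<close>.\<close>
    have "(\<Sum>i\<in>I X. e X i) = e0 X * p X (e0 X) * e0 X"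
      by (simp add: e_def sum_distrib_left[symmetric] sum_distrib_right[symmetric] E_sum[OF X]
          p_e0[OF X])
    then show ?thesis using corner[OF X, of "e0 X"] orth[OF X X] by simp
  qed
  then have "(\<Sum>(X, i)\<in>(SIGMA X:E_T. I X). e X i) = (\<Sum>X\<in>E_T. e0 X)"
    using finI by (subst sum.Sigma[symmetric]) simp_all
  \<comment> \<open>The unit of the idempotent algebra is also the unit of the whole
    algebra.\<close>
  moreover have "is_unity (C_span UNIV) (\<Sum>X\<in>E_T. e0 X)"
    using e0 by (intro is_unity_C_span_UNIV) (simp add: CSoPOI_def)
  ultimately have unity: "is_unity (C_span UNIV) (\<Sum>(X, i)\<in>(SIGMA X:E_T. I X). e X i)"
    by simp
  have "CSoPOI (C_span UNIV) (SIGMA X:E_T. I X) (\<lambda>(X, i). e X i)"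
    unfolding CSoPOI_def
    using finI e_prim e_orth unity by (auto intro!: finite_SigmaI)
  then show ?thesis by (simp add: e_def)
qed

end
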